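(* If in Algorithm 2 (described in the context) the search directions are generated using $(S^{C_t\mu}_{\rho,\delta})^{-1}$ with $C_t$ sufficiently small, then Algorithm 2 is convergent. That is: there exists $\bar C>0$ such that for every $C_t\in(0,\bar C)$, if at every iteration the search direction is computed by $$S^{C_t\mu}_{\rho,\delta}\,\Delta\mathbf y=\boldsymbol\xi_p-A(\Theta^{-1}+\rho I)^{-1}(X^{-1}\boldsymbol\xi_{\mu,\sigma}+\boldsymbol\xi_d),\quad(\Theta^{-1}+\rho I)\Delta\mathbf x=A^T\Delta\mathbf y+\boldsymbol\xi_d+X^{-1}\boldsymbol\xi_{\mu,\sigma},\quad X\Delta\mathbf s=\boldsymbol\xi_{\mu,\sigma}-S\Delta\mathbf x,$$ then Algorithm 2, when it does not stop, produces iterates $(\mathbf x^j,\mathbf y^j,\mathbf s^j)\in\mathcal N_k$ with $\lim_{j\to\infty}(\mathbf x^j)^T\mathbf s^j=0$, and $(\mathbf x^j,\mathbf y^j,\mathbf s^j)$ converges to a solution of PPM$(k)$.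
   Context: Graph setting. $G=(V,E)$ is a connected graph without self-loops with directed edges $E\subset V\times V$, $|V|=m$, $|E|=n\geq 1$; $A\in\{-1,0,1\}^{m\times n}$ is its incidence matrix: $A_{ve}=-1$ if $e=(v,w)$ for some $w$, $A_{ve}=1$ if $e=(w,v)$ for some $w$, $A_{ve}=0$ otherwise. $\mathbf c\in\mathbb R_+^n$ are the edge weights and $\mathbf b=\boldsymbol\rho_1-\boldsymbol\rho_0$, where $\boldsymbol\rho_0,\boldsymbol\rho_1\in\mathbb R^m$ are nonnegative with entries summing to $1$. Let $\rho,\delta>0$ and let $\mathbf x_k\in\mathbb R^n$, $\mathbf y_k\in\mathbb R^m$ be fixed. Problem PPM$(k)$ is: minimize $\mathbf c^T\mathbf x+\frac\rho2\|\mathbf x-\mathbf x_k\|^2+\frac\delta2\|\mathbf y\|^2$ subject to $A\mathbf x+\delta(\mathbf y-\mathbf y_k)=\mathbf b$, $\mathbf x\ge0$. $\|\cdot\|$ is the Euclidean norm, $\mathbf e$ the all-ones vector. A triple $(\mathbf x^*,\mathbf y^*,\mathbf s^* )$ is a solution of PPM$(k)$ if $A\mathbf x^*+\delta(\mathbf y^*-\mathbf y_k)-\mathbf b=0$, $\rho(\mathbf x^*-\mathbf x_k)-A^T\mathbf y^*-\mathbf s^*+\mathbf c=0$, $(\mathbf x^* )^T\mathbf s^*=0$, and $\mathbf x^*,\mathbf s^*\ge0$. Parameters: $0<\underline\gamma<1<\bar\gamma$, $\gamma_p,\gamma_d>0$, $0<\sigma<\bar\sigma<1$, $C_{\text{inexact}}\in(0,1)$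 with $\gamma_pC_{\text{inexact}}<\sigma$. Neighbourhood: $\mathcal N_k$ is the set of $(\mathbf x,\mathbf y,\mathbf s)\in\mathbb R^n_{>0}\times\mathbb R^m\times\mathbb R^n_{>0}$ with $\bar\gamma\,\mathbf x^T\mathbf s/n\ge x_is_i\ge\underline\gamma\,\mathbf x^T\mathbf s/n$ for all $i$, $\mathbf x^T\mathbf s\ge\gamma_p\|A\mathbf x+\delta(\mathbf y-\mathbf y_k)-\mathbf b\|$ and $\mathbf x^T\mathbf s\ge\gamma_d\|\rho(\mathbf x-\mathbf x_k)-A^T\mathbf y-\mathbf s+\mathbf c\|$. At a point $(\mathbf x,\mathbf y,\mathbf s)$ with $\mathbf x,\mathbf s>0$: $X=\mathrm{diag}(\mathbf x)$, $S=\mathrm{diag}(\mathbf s)$, $\Theta=XS^{-1}$, $\mu=\mathbf x^T\mathbf s/n$, $\boldsymbol\xi_d=-(\rho(\mathbf x-\mathbf x_k)-A^T\mathbf y-\mathbf s+\mathbf c)$, $\boldsymbol\xi_p=-(A\mathbf x+\delta(\mathbf y-\mathbf y_k)-\mathbf b)$, $\boldsymbol\xi_{\mu,\sigma}=-(SX\mathbf e-\sigma\mu\mathbf e)$. Sparsified normal matrix: for $C_t>0$, $S^{C_t\mu}_{\rho,\delta}=A\widehat\Theta^\dagger_{C_t\mu,\rho}A^T+\delta I$, where $\widehat\Theta^\dagger_{C_t\mu,\rho}$ is diagonal with $i$-th diagonal entry equal to $(\Theta^{-1}+\rho I)^{-1}_{ii}$ if $(\Theta^{-1}+\rho I)^{-1}_{ii}\ge\frac{C_t\mu}{1+\rho\mu}$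 and $0$ otherwise. Algorithm 2: start from a given $(\mathbf x^0,\mathbf y^0,\mathbf s^0)\in\mathcal N_k$. At iteration $j$, compute the search direction $(\Delta\mathbf x^j,\Delta\mathbf y^j,\Delta\mathbf s^j)$ at $(\mathbf x^j,\mathbf y^j,\mathbf s^j)$ and write $(\mathbf x^j(\alpha),\mathbf y^j(\alpha),\mathbf s^j(\alpha))=(\mathbf x^j,\mathbf y^j,\mathbf s^j)+\alpha(\Delta\mathbf x^j,\Delta\mathbf y^j,\Delta\mathbf s^j)$. Let $\alpha^{*,j}=\min\{\sup\{\alpha:\mathbf x^j(\alpha)\ge0\},\sup\{\alpha:\mathbf s^j(\alpha)\ge0\}\}$; if $\alpha^{*,j}<\infty$ and the point at $\alpha=\alpha^{*,j}$ is a solution of PPM$(k)$, stop. Otherwise let $\alpha^j$ be the maximum $\alpha\in[0,1]$ such that for all $\alpha'\in[0,\alpha]$: $(\mathbf x^j(\alpha'),\mathbf y^j(\alpha'),\mathbf s^j(\alpha'))\in\mathcal N_k$ and $\mathbf x^j(\alpha')^T\mathbf s^j(\alpha')\le(1-(1-\bar\sigma)\alpha')(\mathbf x^j)^T\mathbf s^j$. Set $(\mathbf x^{j+1},\mathbf y^{j+1},\mathbf s^{j+1})=(\mathbf x^j(\alpha^j),\mathbf y^j(\alpha^j),\mathbf s^j(\alpha^j))$ and continue. *)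

theory Defs
  imports "HOL-Analysis.Analysis"
begin

section \<open>Graphs\<close>

text \<open>
  Vertices are the elements of the finite type \<open>'m\<close>. The edge set is enumerated by the finite
  type \<open>'n\<close> through a bijection \<open>edge\<close>, so that vectors indexed by edges are of type
  \<open>real ^ 'n\<close>; since types are nonempty, there is at least one edge. Connectedness ignores
  the orientation of the edges.
\<close>

definition connected_digraph :: "('m \<times> 'm) set \<Rightarrow> bool" where
  "connected_digraph E \<longleftrightarrow> (E \<union> E\<inverse>)\<^sup>* = UNIV"

definition incidence_matrix :: "('n \<Rightarrow> 'm \<times> 'm) \<Rightarrow> real ^ 'n ^ 'm" where
  "incidence_matrix edge =
     (\<chi> v e. if fst (edge e) = v then - 1 else if snd (edge e) = v then 1 else 0)"

definition diag :: "real ^ 'n \<Rightarrow> real ^ 'n ^ 'n" where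
  "diag v = (\<chi> i j. if i = j then v $ i else 0)"


section \<open>The proximal subproblem\<close>

record ('n, 'm) ppm =
  ppm_A :: "real ^ 'n ^ 'm"
  ppm_b :: "real ^ 'm"
  ppm_c :: "real ^ 'n"
  ppm_\<rho> :: real
  ppm_\<delta> :: real
  ppm_xk :: "real ^ 'n"
  ppm_yk :: "real ^ 'm"

type_synonym ('n, 'm) point = "(real ^ 'n) \<times> (real ^ 'm) \<times> (real ^ 'n)"

definition primal_residual ::
    "('n::finite, 'm::finite) ppm \<Rightarrow> real ^ 'n \<Rightarrow> real ^ 'm \<Rightarrow> real ^ 'm" where
  "primal_residual P x y = ppm_A P *v x + ppm_\<delta> P *\<^sub>R (y - ppm_yk P) - ppm_b P"

definition dual_residual ::
    "('n::finite, 'm::finite) ppm \<Rightarrow> real ^ 'n \<Rightarrow> real ^ 'm \<Rightarrow> real ^ 'n \<Rightarrow> real ^ 'n" where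
  "dual_residual P x y s =
     ppm_\<rho> P *\<^sub>R (x - ppm_xk P) - transpose (ppm_A P) *v y - s + ppm_c P"

text \<open>The order on vectors is componentwise.\<close>

definition is_solution :: "('n::finite, 'm::finite) ppm \<Rightarrow> ('n, 'm) point \<Rightarrow> bool" where
  "is_solution P = (\<lambda>(x, y, s).
     primal_residual P x y = 0 \<and> dual_residual P x y s = 0 \<and> x \<bullet> s = 0 \<and> 0 \<le> x \<and> 0 \<le> s)"

definition gap :: "('n::finite, 'm::finite) point \<Rightarrow> real" where
  "gap = (\<lambda>(x, y, s). x \<bullet> s)"

text \<open>Strict positivity is spelled out per component because the strict order that
  accompanies the componentwise order on vectors is weaker.\<close>

definition neighbourhood ::
    "('n::finite, 'm::finite) ppm \<Rightarrow> real \<Rightarrow> real \<Rightarrow> real \<Rightarrow> real \<Rightarrow> ('n, 'm) point set" where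
  "neighbourhood P \<gamma>l \<gamma>u \<gamma>p \<gamma>d = {(x, y, s).
     (\<forall>i. 0 < x $ i) \<and> (\<forall>i. 0 < s $ i) \<and>
     (\<forall>i. \<gamma>u * (x \<bullet> s) / real CARD('n) \<ge> x $ i * s $ i \<and>
          x $ i * s $ i \<ge> \<gamma>l * (x \<bullet> s) / real CARD('n)) \<and>
     x \<bullet> s \<ge> \<gamma>p * norm (primal_residual P x y) \<and>
     x \<bullet> s \<ge> \<gamma>d * norm (dual_residual P x y s)}"


section \<open>Sparsified search directions\<close>

definition Theta :: "real ^ 'n \<Rightarrow> real ^ 'n \<Rightarrow> real ^ 'n ^ 'n::finite" where
  "Theta x s = diag x ** matrix_inv (diag s)"

definition reg_Theta_inv :: "real \<Rightarrow> real ^ 'n \<Rightarrow> real ^ 'n \<Rightarrow> real ^ 'n ^ 'n::finite" where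
  "reg_Theta_inv \<rho> x s = matrix_inv (Theta x s) + \<rho> *\<^sub>R mat 1"

definition sparsified_Theta ::
    "real \<Rightarrow> real \<Rightarrow> real ^ 'n \<Rightarrow> real ^ 'n \<Rightarrow> real ^ 'n ^ 'n::finite" where
  "sparsified_Theta Ct \<rho> x s =
     (let \<mu> = (x \<bullet> s) / real CARD('n); D = matrix_inv (reg_Theta_inv \<rho> x s)
      in diag (\<chi> i. if D $ i $ i \<ge> Ct * \<mu> / (1 + \<rho> * \<mu>) then D $ i $ i else 0))"

definition sparsified_normal_matrix ::
    "('n::finite, 'm::finite) ppm \<Rightarrow> real \<Rightarrow> real ^ 'n \<Rightarrow> real ^ 'n \<Rightarrow> real ^ 'm ^ 'm" where
  "sparsified_normal_matrix P Ct x s =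
     ppm_A P ** sparsified_Theta Ct (ppm_\<rho> P) x s ** transpose (ppm_A P) + ppm_\<delta> P *\<^sub>R mat 1"

text \<open>Here \<open>vec 1\<close> is the all-ones vector.\<close>

definition is_sparsified_direction ::
    "('n::finite, 'm::finite) ppm \<Rightarrow> real \<Rightarrow> real \<Rightarrow> ('n, 'm) point \<Rightarrow> ('n, 'm) point \<Rightarrow> bool" where
  "is_sparsified_direction P Ct \<sigma> = (\<lambda>(x, y, s) (\<Delta>x, \<Delta>y, \<Delta>s).
     let X = diag x; S = diag s; \<mu> = (x \<bullet> s) / real CARD('n);
         H = reg_Theta_inv (ppm_\<rho> P) x s;
         \<xi>p = - primal_residual P x y;
         \<xi>d = - dual_residual P x y s;
         \<xi>\<mu> = - (S *v (X *v vec 1) - (\<sigma> * \<mu>) *\<^sub>R vec 1)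
     in sparsified_normal_matrix P Ct x s *v \<Delta>y
          = \<xi>p - ppm_A P *v (matrix_inv H *v (matrix_inv X *v \<xi>\<mu> + \<xi>d)) \<and>
        H *v \<Delta>x = transpose (ppm_A P) *v \<Delta>y + \<xi>d + matrix_inv X *v \<xi>\<mu> \<and>
        X *v \<Delta>s = \<xi>\<mu> - S *v \<Delta>x)"


section \<open>The inexact interior point method\<close>

definition max_step :: "('n::finite, 'm::finite) point \<Rightarrow> ('n, 'm) point \<Rightarrow> ereal" where
  "max_step = (\<lambda>(x, y, s) (\<Delta>x, \<Delta>y, \<Delta>s).
     min (SUP \<alpha>\<in>{\<alpha>. 0 \<le> x + \<alpha> *\<^sub>R \<Delta>x}. ereal \<alpha>) (SUP \<alpha>\<in>{\<alpha>. 0 \<le> s + \<alpha> *\<^sub>R \<Delta>s}. ereal \<alpha>))"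

definition stops :: "('n::finite, 'm::finite) ppm \<Rightarrow> ('n, 'm) point \<Rightarrow> ('n, 'm) point \<Rightarrow> bool" where
  "stops P p d \<longleftrightarrow>
     max_step p d < \<infinity> \<and> is_solution P (p + real_of_ereal (max_step p d) *\<^sub>R d)"

definition admissible_steps ::
    "('n::finite, 'm::finite) ppm \<Rightarrow> real \<Rightarrow> real \<Rightarrow> real \<Rightarrow> real \<Rightarrow> real
      \<Rightarrow> ('n, 'm) point \<Rightarrow> ('n, 'm) point \<Rightarrow> real set" where
  "admissible_steps P \<gamma>l \<gamma>u \<gamma>p \<gamma>d \<sigma>bar p d = {\<alpha> \<in> {0..1}. \<forall>\<alpha>'\<in>{0..\<alpha>}.
     p + \<alpha>' *\<^sub>R d \<in> neighbourhood P \<gamma>l \<gamma>u \<gamma>p \<gamma>d \<and>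
     gap (p + \<alpha>' *\<^sub>R d) \<le> (1 - (1 - \<sigma>bar) * \<alpha>') * gap p}"

definition step_length ::
    "('n::finite, 'm::finite) ppm \<Rightarrow> real \<Rightarrow> real \<Rightarrow> real \<Rightarrow> real \<Rightarrow> real
      \<Rightarrow> ('n, 'm) point \<Rightarrow> ('n, 'm) point \<Rightarrow> real" where
  "step_length P \<gamma>l \<gamma>u \<gamma>p \<gamma>d \<sigma>bar p d =
     (GREATEST \<alpha>. \<alpha> \<in> admissible_steps P \<gamma>l \<gamma>u \<gamma>p \<gamma>d \<sigma>bar p d)"

text \<open>A run that never stops, with iterates \<open>z j\<close> and search directions \<open>d j\<close>. How the
  directions are computed is left open, and only the starting point is required to lie in the
  neighbourhood.\<close>

definition nonstopping_run ::
    "('n::finite, 'm::finite) ppm \<Rightarrow> real \<Rightarrow> real \<Rightarrow> real \<Rightarrow> real \<Rightarrow> real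
      \<Rightarrow> (nat \<Rightarrow> ('n, 'm) point) \<Rightarrow> (nat \<Rightarrow> ('n, 'm) point) \<Rightarrow> bool" where
  "nonstopping_run P \<gamma>l \<gamma>u \<gamma>p \<gamma>d \<sigma>bar z d \<longleftrightarrow>
     z 0 \<in> neighbourhood P \<gamma>l \<gamma>u \<gamma>p \<gamma>d \<and>
     (\<forall>j. \<not> stops P (z j) (d j) \<and>
          z (Suc j) = z j + step_length P \<gamma>l \<gamma>u \<gamma>p \<gamma>d \<sigma>bar (z j) (d j) *\<^sub>R d j)"

end

theory Submission
  imports Defs
begin

text \<open>
  Write \<open>H = \<Theta>\<inverse> + \<rho> I\<close>, \<open>D = H\<inverse>\<close>, and \<open>D'\<close> for \<open>D\<close> with its small entries replaced by \<open>0\<close>. A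
  sparsified direction satisfies the linearised dual and complementarity equations of Newton's
  method exactly; only the primal equation is perturbed, by the residual
  \<open>r = A (D - D') A\<^sup>T \<Delta>y\<close> (\<open>sparsified_direction_equations\<close>). Dropping an entry changes \<open>D\<close> by at
  most \<open>Ct \<mu> / (1 + \<rho> \<mu>)\<close>, so \<open>r\<close> is a small multiple of \<open>\<mu>\<close> as soon as \<open>\<Delta>y\<close> grows at most
  linearly with \<open>1 + \<mu>\<close>.

  The proximal regularisation provides this and more (\<open>direction_bounds\<close>). The regularised normal
  matrix is bounded below by \<open>\<delta> I\<close>, the entries of \<open>D\<close> are at most \<open>1 / \<rho>\<close>, and the entries
  \<open>(\<sigma> \<mu> - x\<^sub>i s\<^sub>i) / (s\<^sub>i + \<rho> x\<^sub>i)\<close> of \<open>D X\<inverse> \<xi>\<^sub>\<mu>\<close> are of order \<open>sqrt \<mu>\<close>, because \<open>x\<^sub>i s\<^sub>i\<close> is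
  comparable to \<open>\<mu>\<close> in the neighbourhood. Hence the whole direction is bounded by
  \<open>K (sqrt \<mu> + \<mu>)\<close>, with a constant \<open>K\<close> that depends neither on the point nor on \<open>Ct\<close>. In
  particular the quadratic terms \<open>\<Delta>x\<^sub>i \<Delta>s\<^sub>i\<close> are at most \<open>B \<mu>\<close> while \<open>\<mu>\<close> stays bounded, and the
  classical path-following estimate yields a lower bound, uniform along the run, for the steps that
  stay in the neighbourhood and decrease the gap (\<open>step_in_neighbourhood\<close>, \<open>uniform_step\<close>).

  The maximal step exists (\<open>greatest_admissible_step\<close>): the neighbourhood is not closed, but a
  limit point outside of it has zero gap, hence is a solution, and then the run would have stopped.
  Consequently the gap decreases geometrically, the increments of the iterates, being of order
  \<open>sqrt \<mu> + \<mu>\<close>, are summable, and the limit of the iterates is a limit point of the neighbourhood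
  with zero gap, which is a solution.
\<close>


section \<open>Diagonal matrices\<close>

lemma diag_mult_vec: "diag v *v w = (\<chi> i. v $ i * w $ i)"
  by (simp add: diag_def matrix_vector_mult_def vec_eq_iff if_distrib [where f = "\<lambda>t. t * _"]
      cong: if_cong)

lemma diag_mult_vec_nth [simp]: "(diag v *v w) $ i = v $ i * w $ i"
  by (simp add: diag_mult_vec)

lemma diag_nth_nth [simp]: "diag v $ i $ i = v $ i"
  by (simp add: diag_def)

lemma diag_mult_diag: "diag v ** diag w = diag (\<chi> i. v $ i * w $ i)"
  by (simp add: matrix_eq vec_eq_iff flip: matrix_vector_mul_assoc)

lemma diag_plus_scaled_identity: "diag v + r *\<^sub>R mat 1 = diag (\<chi> i. v $ i + r)"
  by (simp add: diag_def mat_def vec_eq_iff)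

lemma matrix_inv_diag:
  fixes v :: "real ^ 'n::finite"
  assumes "\<And>i. v $ i \<noteq> 0"
  shows "matrix_inv (diag v) = diag (\<chi> i. 1 / v $ i)" (is "_ = ?W")
proof -
  have 1: "diag v ** ?W = mat 1" "?W ** diag v = mat 1"
    using assms by (auto simp: diag_mult_diag) (auto simp: diag_def mat_def vec_eq_iff)
  then have "\<exists>W. diag v ** W = mat 1 \<and> W ** diag v = mat 1"
    by blast
  then have 2: "matrix_inv (diag v) ** diag v = mat 1"
    unfolding matrix_inv_def by (rule someI2_ex) blast
  have "matrix_inv (diag v) = matrix_inv (diag v) ** (diag v ** ?W)"
    by (simp add: 1)
  also have "\<dots> = ?W"
    by (simp add: matrix_mul_assoc 2)
  finally show ?thesis .
qed

lemma norm_diag_mult_vec_le: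
  fixes w v :: "real ^ 'n::finite"
  assumes "\<And>i. \<bar>w $ i\<bar> \<le> c"
  shows "norm (diag w *v v) \<le> c * norm v"
proof -
  have "0 \<le> c"
    using assms [of undefined] by linarith
  have "norm (diag w *v v) \<le> norm (c *\<^sub>R v)"
    using assms \<open>0 \<le> c\<close>
    by (intro norm_le_componentwise_cart allI) (auto simp: abs_mult intro!: mult_right_mono)
  then show ?thesis
    using \<open>0 \<le> c\<close> by simp
qed


section \<open>The sparsified direction as a perturbed Newton direction\<close>

lemma reg_Theta_inv_eq_diag:
  fixes x s :: "real ^ 'n::finite"
  assumes "\<And>i. 0 < x $ i" "\<And>i. 0 < s $ i"
  shows "reg_Theta_inv \<rho> x s = diag (\<chi> i. s $ i / x $ i + \<rho>)"
proof -
  have [simp]: "x $ i \<noteq> 0" "s $ i \<noteq> 0" for i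
    using assms [of i] by auto
  have "Theta x s = diag (\<chi> i. x $ i / s $ i)"
    by (simp add: Theta_def matrix_inv_diag diag_mult_diag)
  then have "matrix_inv (Theta x s) = diag (\<chi> i. s $ i / x $ i)"
    by (simp add: matrix_inv_diag)
  then show ?thesis
    by (simp add: reg_Theta_inv_def diag_plus_scaled_identity)
qed

text \<open>
  In the conclusions, \<open>diag v\<close> is the sparsified matrix and \<open>\<eta>\<close> is the product of
  \<open>(\<Theta>\<inverse> + \<rho> I)\<inverse>\<close> with \<open>X\<inverse> \<xi>\<^sub>\<mu>\<close>. The last two equations are those of the exact Newton system.
\<close>

lemma sparsified_direction_equations:
  fixes P :: "('n::finite, 'm::finite) ppm" and x s dx ds :: "real ^ 'n" and y dy :: "real ^ 'm"
  assumes dir: "is_sparsified_direction P Ct \<sigma> (x, y, s) (dx, dy, ds)"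
    and x: "\<And>i. 0 < x $ i" and s: "\<And>i. 0 < s $ i" and \<rho>: "0 < ppm_\<rho> P" and Ct: "0 < Ct"
  defines "\<mu> \<equiv> x \<bullet> s / real CARD('n)"
  defines "w \<equiv> \<chi> i. 1 / (s $ i / x $ i + ppm_\<rho> P)"
  defines "\<eta> \<equiv> \<chi> i. (\<sigma> * \<mu> - x $ i * s $ i) / (s $ i + ppm_\<rho> P * x $ i)"
  obtains v where
    "\<And>i. 0 \<le> v $ i \<and> \<bar>w $ i - v $ i\<bar> \<le> Ct * \<mu> / (1 + ppm_\<rho> P * \<mu>)"
    "ppm_A P *v (diag v *v (transpose (ppm_A P) *v dy)) + ppm_\<delta> P *\<^sub>R dy
       = - primal_residual P x y - ppm_A P *v (\<eta> - diag w *v dual_residual P x y s)"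
    "dx = diag w *v (transpose (ppm_A P) *v dy - dual_residual P x y s) + \<eta>"
    "ds = ppm_\<rho> P *\<^sub>R dx - transpose (ppm_A P) *v dy + dual_residual P x y s"
    "\<And>i. s $ i * dx $ i + x $ i * ds $ i = \<sigma> * \<mu> - x $ i * s $ i"
proof -
  let ?\<rho> = "ppm_\<rho> P" and ?A = "ppm_A P" and ?q = "dual_residual P x y s"
  let ?\<tau> = "Ct * \<mu> / (1 + ?\<rho> * \<mu>)"
  define h where "h = (\<chi> i. s $ i / x $ i + ?\<rho>)"
  define v where "v = (\<chi> i. if w $ i \<ge> ?\<tau> then w $ i else 0)"
  define \<zeta> where "\<zeta> = (\<chi> i. (\<sigma> * \<mu> - x $ i * s $ i) / x $ i)"
  have x0: "x $ i \<noteq> 0" for i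
    using x [of i] by simp
  have h_pos: "0 < h $ i" for i
    using x [of i] s [of i] \<rho> by (auto simp: h_def intro!: add_pos_pos)
  have h0: "h $ i \<noteq> 0" for i
    using h_pos [of i] by simp
  have w_h: "w $ i = 1 / h $ i" for i
    by (simp add: w_def h_def)
  have w_pos: "0 < w $ i" for i
    using h_pos by (simp add: w_h)
  have \<mu>: "0 \<le> \<mu>"
    unfolding \<mu>_def inner_vec_def using x s
    by (auto intro!: divide_nonneg_nonneg sum_nonneg mult_nonneg_nonneg simp: less_imp_le)
  then have \<tau>: "0 \<le> ?\<tau>"
    using \<rho> Ct by (auto intro!: divide_nonneg_nonneg add_nonneg_nonneg mult_nonneg_nonneg)
  have H: "reg_Theta_inv ?\<rho> x s = diag h"
    using x s by (simp add: reg_Theta_inv_eq_diag h_def)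
  have Hinv: "matrix_inv (diag h) = diag w"
    by (simp add: matrix_inv_diag h0) (simp add: w_h vec_eq_iff diag_def)
  have sT: "sparsified_Theta Ct ?\<rho> x s = diag v"
    by (simp add: sparsified_Theta_def H Hinv v_def Let_def flip: \<mu>_def cong: if_cong)
  have \<xi>: "matrix_inv (diag x) *v (- (diag s *v (diag x *v vec 1) - (\<sigma> * \<mu>) *\<^sub>R vec 1)) = \<zeta>"
    using x0 by (simp add: matrix_inv_diag vec_eq_iff \<zeta>_def mult.commute)
  have w\<zeta>: "diag w *v \<zeta> = \<eta>"
    using x0 h0 x by (simp add: vec_eq_iff w_def \<zeta>_def \<eta>_def distrib_right)
  have eqs: "sparsified_normal_matrix P Ct x s *v dy
          = - primal_residual P x y - ?A *v (diag w *v (\<zeta> - ?q))"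
        "diag h *v dx = transpose ?A *v dy - ?q + \<zeta>"
        "diag x *v ds = - (diag s *v (diag x *v vec 1) - (\<sigma> * \<mu>) *\<^sub>R vec 1) - diag s *v dx"
    using dir unfolding is_sparsified_direction_def Let_def prod.case H Hinv \<mu>_def [symmetric] \<xi>
    by (simp_all)
  have comp: "s $ i * dx $ i + x $ i * ds $ i = \<sigma> * \<mu> - x $ i * s $ i" for i
    using arg_cong [OF eqs(3), of "\<lambda>t. t $ i"] by (simp add: algebra_simps)
  have "dx = diag w *v (diag h *v dx)"
    using h0 by (simp add: vec_eq_iff w_h)
  then have dx: "dx = diag w *v (transpose ?A *v dy - ?q) + \<eta>"
    by (simp add: eqs(2) matrix_vector_right_distrib w\<zeta>)
  have ds: "ds = ?\<rho> *\<^sub>R dx - transpose ?A *v dy + ?q"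
    unfolding vec_eq_iff
  proof
    fix i
    have "(s $ i / x $ i + ?\<rho>) * dx $ i = (transpose ?A *v dy) $ i - ?q $ i + \<zeta> $ i"
      using arg_cong [OF eqs(2), of "\<lambda>t. t $ i"] by (simp add: h_def)
    moreover have "ds $ i = (\<sigma> * \<mu> - x $ i * s $ i - s $ i * dx $ i) / x $ i"
      using comp [of i] x0 [of i] by (simp add: eq_divide_eq algebra_simps)
    then have "ds $ i = \<zeta> $ i - s $ i / x $ i * dx $ i"
      by (simp add: \<zeta>_def diff_divide_distrib)
    ultimately show "ds $ i = (?\<rho> *\<^sub>R dx - transpose ?A *v dy + ?q) $ i"
      by (simp add: algebra_simps)
  qed
  show thesis
  proof (rule that [of v])
    show "0 \<le> v $ i \<and> \<bar>w $ i - v $ i\<bar> \<le> ?\<tau>" for i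
      using w_pos [of i] \<tau> by (auto simp: v_def)
    show "?A *v (diag v *v (transpose ?A *v dy)) + ppm_\<delta> P *\<^sub>R dy
       = - primal_residual P x y - ?A *v (\<eta> - diag w *v ?q)"
      using eqs(1)
      by (simp add: sparsified_normal_matrix_def sT matrix_vector_mult_add_rdistrib
          matrix_vector_mult_diff_distrib w\<zeta> scaleR_matrix_vector_assoc [symmetric]
          flip: matrix_vector_mul_assoc)
  qed (use dx ds comp in auto)
qed


lemma regularised_normal_matrix_lower_bound:
  fixes A :: "real ^ 'n::finite ^ 'm::finite"
  assumes v: "\<And>i. 0 \<le> v $ i"
  shows "\<delta> * norm y \<le> norm (A *v (diag v *v (transpose A *v y)) + \<delta> *\<^sub>R y)" (is "_ \<le> norm ?r")
proof (cases "y = 0")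
  case False
  define t where "t = transpose A *v y"
  have "0 \<le> t \<bullet> (diag v *v t)"
    unfolding inner_vec_def using v
    by (auto intro!: sum_nonneg) (metis mult.left_commute mult_nonneg_nonneg zero_le_square)
  then have "\<delta> * (norm y)\<^sup>2 \<le> y \<bullet> ?r"
    by (simp add: t_def inner_add_right dot_lmul_matrix power2_norm_eq_inner)
  also have "\<dots> \<le> norm y * norm ?r"
    by (rule norm_cauchy_schwarz)
  finally have "norm y * (\<delta> * norm y) \<le> norm y * norm ?r"
    by (simp add: power2_eq_square algebra_simps)
  then show ?thesis
    using False by simp
qed simp

text \<open>
  The data of the method, with the constraint matrix left arbitrary.
\<close>

locale inexact_ipm =
  fixes P :: "('n::finite, 'm::finite) ppm"
    and \<gamma>l \<gamma>u \<gamma>p \<gamma>d \<sigma> \<sigma>bar :: real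
  assumes \<rho>: "0 < ppm_\<rho> P" and \<delta>: "0 < ppm_\<delta> P"
    and \<gamma>l: "0 < \<gamma>l" "\<gamma>l < 1" and \<gamma>u: "1 < \<gamma>u"
    and \<gamma>p: "0 < \<gamma>p" and \<gamma>d: "0 < \<gamma>d"
    and \<sigma>: "0 < \<sigma>" "\<sigma> < \<sigma>bar" "\<sigma>bar < 1"
begin

abbreviation N :: "('n, 'm) point set" where
  "N \<equiv> neighbourhood P \<gamma>l \<gamma>u \<gamma>p \<gamma>d"

text \<open>The average complementarity product.\<close>

abbreviation mu :: "('n, 'm) point \<Rightarrow> real" where
  "mu z \<equiv> gap z / real CARD('n)"

lemma gap_pos:
  assumes "z \<in> N"
  shows "0 < gap z"
proof -
  obtain x y s where z: "z = (x, y, s)"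
    by (cases z)
  show ?thesis
    using assms unfolding z gap_def neighbourhood_def inner_vec_def
    by (auto intro!: sum_pos)
qed

lemma neighbourhood_ineqs:
  assumes "(x, y, s) \<in> N"
  shows "0 < x $ i" "0 < s $ i"
    "\<gamma>l * mu (x, y, s) \<le> x $ i * s $ i" "x $ i * s $ i \<le> \<gamma>u * mu (x, y, s)"
    "norm (primal_residual P x y) \<le> gap (x, y, s) / \<gamma>p"
    "norm (dual_residual P x y s) \<le> gap (x, y, s) / \<gamma>d"
  using assms \<gamma>p \<gamma>d by (auto simp: neighbourhood_def gap_def field_simps)

text \<open>
  The constant is chosen before the point and before \<open>Ct\<close>. This is why the threshold for \<open>Ct\<close> does
  not depend on the starting point of the run.
\<close>

lemma direction_bounds:
  obtains K where "0 < K"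
    "\<And>x y s dx dy ds Ct.
       (x, y, s) \<in> N \<Longrightarrow> 0 < Ct \<Longrightarrow> is_sparsified_direction P Ct \<sigma> (x, y, s) (dx, dy, ds) \<Longrightarrow>
       norm dx \<le> K * (sqrt (mu (x, y, s)) + mu (x, y, s)) \<and>
       norm dy \<le> K * (sqrt (mu (x, y, s)) + mu (x, y, s)) \<and>
       norm ds \<le> K * (sqrt (mu (x, y, s)) + mu (x, y, s)) \<and>
       norm (ppm_A P *v dx + ppm_\<delta> P *\<^sub>R dy + primal_residual P x y) \<le> Ct * K * mu (x, y, s)"
proof -
  let ?\<rho> = "ppm_\<rho> P" and ?\<delta> = "ppm_\<delta> P" and ?A = "ppm_A P" and ?n = "real CARD('n)"
  obtain a1 where a1: "a1 > 0" "\<And>t. norm (?A *v t) \<le> norm t * a1"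
    using bounded_linear.pos_bounded [OF matrix_vector_mul_bounded_linear [of ?A]] by blast
  obtain a2 where a2: "a2 > 0" "\<And>t. norm (transpose ?A *v t) \<le> norm t * a2"
    using bounded_linear.pos_bounded [OF matrix_vector_mul_bounded_linear [of "transpose ?A"]]
    by blast
  define a where "a = max a1 a2"
  have a: "0 < a" "norm (?A *v t) \<le> a * norm t" "norm (transpose ?A *v t') \<le> a * norm t'" for t t'
  proof -
    show "0 < a" using a1 by (simp add: a_def)
    show "norm (?A *v t) \<le> a * norm t"
      using a1(2) [of t] mult_left_mono [of a1 a "norm t"] by (simp add: a_def mult.commute)
    show "norm (transpose ?A *v t') \<le> a * norm t'"
      using a2(2) [of t'] mult_left_mono [of a2 a "norm t'"] by (simp add: a_def mult.commute)
  qed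
  define Kp where "Kp = ?n / \<gamma>p"
  define Kd where "Kd = ?n / \<gamma>d"
  define K\<eta> where "K\<eta> = ?n * (\<gamma>u / sqrt (?\<rho> * \<gamma>l))"
  define Ky where "Ky = (Kp + a * (K\<eta> + Kd / ?\<rho>)) / ?\<delta>"
  define Kx where "Kx = (a * Ky + Kd) / ?\<rho> + K\<eta>"
  define Ks where "Ks = ?\<rho> * Kx + a * Ky + Kd"
  define Kr where "Kr = a * (a * Ky * (1 + 2 / ?\<rho>))"
  have pos: "0 < Kp" "0 < Kd" "0 < K\<eta>"
    using \<gamma>p \<gamma>d \<gamma>u \<gamma>l \<rho> by (simp_all add: Kp_def Kd_def K\<eta>_def)
  then have "0 < Ky"
    using a(1) \<rho> \<delta> by (auto simp: Ky_def intro!: divide_pos_pos add_pos_pos mult_pos_pos)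
  moreover from this have "0 < Kx"
    using a(1) \<rho> pos by (auto simp: Kx_def intro!: divide_pos_pos add_pos_pos mult_pos_pos)
  moreover from calculation have "0 < Ks" "0 < Kr"
    using a(1) \<rho> pos by (auto simp: Ks_def Kr_def intro!: divide_pos_pos add_pos_pos mult_pos_pos)
  ultimately have pos': "0 < Ky" "0 < Kx" "0 < Ks" "0 < Kr"
    by auto
  show thesis
  proof (rule that [of "Kx + Ky + Ks + Kr"])
    show "0 < Kx + Ky + Ks + Kr"
      using pos' by linarith
    fix x s dx ds :: "real ^ 'n" and y dy :: "real ^ 'm" and Ct :: real
    assume z: "(x, y, s) \<in> N" and Ct: "0 < Ct"
      and dir: "is_sparsified_direction P Ct \<sigma> (x, y, s) (dx, dy, ds)"
    define \<mu> where "\<mu> = mu (x, y, s)"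
    define u where "u = sqrt \<mu> + \<mu>"
    define p where "p = primal_residual P x y"
    define q where "q = dual_residual P x y s"
    define w where "w = (\<chi> i. 1 / (s $ i / x $ i + ?\<rho>))"
    define \<eta> where "\<eta> = (\<chi> i. (\<sigma> * \<mu> - x $ i * s $ i) / (s $ i + ?\<rho> * x $ i))"
    have \<mu>_eq: "\<mu> = x \<bullet> s / ?n"
      by (simp add: \<mu>_def gap_def)
    have \<mu>: "0 < \<mu>"
      using gap_pos [OF z] by (simp add: \<mu>_def)
    have u: "sqrt \<mu> \<le> u" "\<mu> \<le> u" "0 < u"
      using \<mu> by (auto simp: u_def add_pos_pos)
    obtain v where v: "\<And>i. 0 \<le> v $ i \<and> \<bar>w $ i - v $ i\<bar> \<le> Ct * \<mu> / (1 + ?\<rho> * \<mu>)"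
      and ny: "?A *v (diag v *v (transpose ?A *v dy)) + ?\<delta> *\<^sub>R dy = - p - ?A *v (\<eta> - diag w *v q)"
      and dx: "dx = diag w *v (transpose ?A *v dy - q) + \<eta>"
      and ds: "ds = ?\<rho> *\<^sub>R dx - transpose ?A *v dy + q"
      using sparsified_direction_equations [OF dir neighbourhood_ineqs(1,2) [OF z] \<rho> Ct]
      unfolding \<mu>_eq w_def \<eta>_def p_def q_def by blast
    have w: "\<bar>w $ i\<bar> \<le> 1 / ?\<rho>" for i
    proof -
      have "0 < s $ i / x $ i"
        using neighbourhood_ineqs(1,2) [OF z] by simp
      then show ?thesis
        using \<rho> by (simp add: w_def frac_le)
    qed
    have p: "norm p \<le> Kp * u"
    proof -
      have "norm p \<le> Kp * \<mu>"
        using neighbourhood_ineqs(5) [OF z] by (simp add: p_def Kp_def \<mu>_def)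
      then show ?thesis
        using order_trans mult_left_mono [OF u(2), of Kp] pos by (meson less_imp_le)
    qed
    have q: "norm q \<le> Kd * u"
    proof -
      have "norm q \<le> Kd * \<mu>"
        using neighbourhood_ineqs(6) [OF z] by (simp add: q_def Kd_def \<mu>_def)
      then show ?thesis
        using order_trans mult_left_mono [OF u(2), of Kd] pos by (meson less_imp_le)
    qed
    \<comment> \<open>The arithmetic-geometric mean inequality bounds the denominators of \<open>\<eta>\<close> from below by a
      multiple of \<open>sqrt \<mu>\<close>, whereas the numerators are of order \<open>\<mu>\<close>.\<close>
    have \<eta>: "norm \<eta> \<le> K\<eta> * u"
    proof -
      have "\<bar>\<eta> $ i\<bar> \<le> \<gamma>u / sqrt (?\<rho> * \<gamma>l) * sqrt \<mu>" for i
      proof -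
        note i = neighbourhood_ineqs(1-4) [OF z, of i, folded \<mu>_def]
        have "0 < x $ i * s $ i" using i by simp
        have "\<sigma> * \<mu> \<le> 1 * \<mu>" "1 * \<mu> \<le> \<gamma>u * \<mu>"
          using \<sigma> \<mu> \<gamma>u by (auto intro!: mult_right_mono)
        moreover have "0 < \<sigma> * \<mu>"
          using \<sigma> \<mu> by simp
        ultimately have num: "\<bar>\<sigma> * \<mu> - x $ i * s $ i\<bar> \<le> \<gamma>u * \<mu>"
          using i(4) \<open>0 < x $ i * s $ i\<close> by linarith
        have "?\<rho> * \<gamma>l * \<mu> \<le> ?\<rho> * (x $ i * s $ i)"
          using i(3) \<rho> by (simp add: mult.assoc)
        also have "\<dots> \<le> (s $ i + ?\<rho> * x $ i)\<^sup>2"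
        proof -
          have "0 \<le> (s $ i)\<^sup>2 + (?\<rho> * x $ i)\<^sup>2 + ?\<rho> * (x $ i * s $ i)"
            using \<rho> i by simp
          then show ?thesis
            by (simp add: power2_eq_square algebra_simps)
        qed
        finally have "sqrt (?\<rho> * \<gamma>l * \<mu>) \<le> s $ i + ?\<rho> * x $ i"
          using \<rho> i by (intro real_le_lsqrt) auto
        then have den: "sqrt (?\<rho> * \<gamma>l) * sqrt \<mu> \<le> s $ i + ?\<rho> * x $ i"
          by (simp add: real_sqrt_mult)
        have den_pos: "0 < sqrt (?\<rho> * \<gamma>l) * sqrt \<mu>"
          using \<rho> \<gamma>l \<mu> by simp
        have "\<bar>\<eta> $ i\<bar> = \<bar>\<sigma> * \<mu> - x $ i * s $ i\<bar> / (s $ i + ?\<rho> * x $ i)"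
          using den den_pos by (simp add: \<eta>_def)
        also have "\<dots> \<le> \<gamma>u * \<mu> / (sqrt (?\<rho> * \<gamma>l) * sqrt \<mu>)"
          using num den den_pos by (intro frac_le) auto
        also have "\<dots> = \<gamma>u / sqrt (?\<rho> * \<gamma>l) * sqrt \<mu>"
          using \<mu> nonzero_mult_divide_mult_cancel_right
            [of "sqrt \<mu>" "\<gamma>u * sqrt \<mu>" "sqrt (?\<rho> * \<gamma>l)"]
          by (simp add: mult.assoc)
        finally show ?thesis .
      qed
      then have "norm \<eta> \<le> (\<Sum>i\<in>(UNIV :: 'n set). \<gamma>u / sqrt (?\<rho> * \<gamma>l) * sqrt \<mu>)"
        by (intro order_trans [OF norm_le_l1_cart] sum_mono)
      also have "\<dots> = K\<eta> * sqrt \<mu>"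
        by (simp add: K\<eta>_def)
      also have "\<dots> \<le> K\<eta> * u"
        using u pos by simp
      finally show ?thesis .
    qed
    have wq: "norm (diag w *v q) \<le> Kd / ?\<rho> * u"
      using order_trans [OF norm_diag_mult_vec_le [OF w] mult_left_mono [OF q]] \<rho> by simp
    have "?\<delta> * norm dy \<le> norm (- p - ?A *v (\<eta> - diag w *v q))"
      unfolding ny [symmetric] using v by (intro regularised_normal_matrix_lower_bound) auto
    also have "\<dots> \<le> norm p + a * norm (\<eta> - diag w *v q)"
      using norm_triangle_ineq4 [of "- p" "?A *v (\<eta> - diag w *v q)"] a(2) [of "\<eta> - diag w *v q"]
      by simp
    also have "\<dots> \<le> Kp * u + a * (K\<eta> * u + Kd / ?\<rho> * u)"
      using p \<eta> wq a(1) norm_triangle_ineq4 [of \<eta> "diag w *v q"]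
      by (intro add_mono mult_left_mono) auto
    also have "\<dots> = (?\<delta> * Ky) * u"
      using \<delta> by (simp add: Ky_def) (simp add: algebra_simps)
    also have "\<dots> = ?\<delta> * (Ky * u)"
      by (rule mult.assoc)
    finally have dy_le: "norm dy \<le> Ky * u"
      using \<delta> by simp
    have tdy_le: "norm (transpose ?A *v dy) \<le> a * Ky * u"
      using order_trans [OF a(3) mult_left_mono [OF dy_le]] a(1) by (simp add: mult.assoc)
    have "norm (diag w *v (transpose ?A *v dy - q)) \<le> 1 / ?\<rho> * (a * Ky * u + Kd * u)"
      using tdy_le q \<rho> norm_triangle_ineq4 [of "transpose ?A *v dy" q]
      by (intro order_trans [OF norm_diag_mult_vec_le [OF w]] mult_left_mono) auto
    then have dx_le: "norm dx \<le> Kx * u"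
      unfolding dx using \<eta> norm_triangle_ineq [of "diag w *v (transpose ?A *v dy - q)" \<eta>]
      by (simp add: Kx_def algebra_simps add_divide_distrib)
    have "norm ds \<le> norm (?\<rho> *\<^sub>R dx) + norm (transpose ?A *v dy) + norm q"
      unfolding ds by (meson add_mono norm_triangle_ineq norm_triangle_ineq4 order_refl order_trans)
    also have "norm (?\<rho> *\<^sub>R dx) \<le> ?\<rho> * (Kx * u)"
      using dx_le \<rho> by simp
    finally have ds_le: "norm ds \<le> Ks * u"
      using tdy_le q by (simp add: Ks_def algebra_simps)
    have r_le: "norm (?A *v dx + ?\<delta> *\<^sub>R dy + p) \<le> Ct * Kr * \<mu>"
    proof -
      let ?\<tau> = "Ct * \<mu> / (1 + ?\<rho> * \<mu>)"
      have \<tau>: "0 \<le> ?\<tau>"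
        using Ct \<mu> \<rho> by (intro divide_nonneg_pos add_pos_pos mult_nonneg_nonneg) auto
      have "?A *v dx + ?\<delta> *\<^sub>R dy + p
          = ?A *v (dx - (\<eta> - diag w *v q) - diag v *v (transpose ?A *v dy))"
        using ny by (simp add: matrix_vector_mult_diff_distrib algebra_simps)
      also have "dx - (\<eta> - diag w *v q) - diag v *v (transpose ?A *v dy)
          = diag (w - v) *v (transpose ?A *v dy)"
        unfolding dx by (simp add: vec_eq_iff algebra_simps)
      also have "norm (?A *v \<dots>) \<le> a * (?\<tau> * (a * Ky * u))"
        using v tdy_le a(1) \<tau>
        by (intro order_trans [OF a(2)] mult_left_mono
            order_trans [OF norm_diag_mult_vec_le [of _ ?\<tau>]]) auto
      also have "\<dots> = a * (a * Ky * (Ct * \<mu> * (u / (1 + ?\<rho> * \<mu>))))"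
        by simp
      also have "\<dots> \<le> a * (a * Ky * (Ct * \<mu> * (1 + 2 / ?\<rho>)))"
      proof -
        have "sqrt \<mu> \<le> 1 + \<mu>"
          using \<mu> by (intro real_le_lsqrt) (auto simp: power2_eq_square algebra_simps)
        moreover have "(1 + 2 / ?\<rho>) * (1 + ?\<rho> * \<mu>) = 1 + 2 * \<mu> + (?\<rho> * \<mu> + 2 / ?\<rho>)"
          using \<rho> by (simp add: distrib_left distrib_right)
        moreover have "0 \<le> ?\<rho> * \<mu> + 2 / ?\<rho>"
          using \<mu> \<rho> by simp
        ultimately have "u \<le> (1 + 2 / ?\<rho>) * (1 + ?\<rho> * \<mu>)"
          unfolding u_def by linarith
        then have "u / (1 + ?\<rho> * \<mu>) \<le> 1 + 2 / ?\<rho>"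
          using \<mu> \<rho> by (simp add: pos_divide_le_eq add_pos_pos)
        then show ?thesis
          using a(1) pos' Ct \<mu> by (intro mult_left_mono) auto
      qed
      also have "\<dots> = Ct * Kr * \<mu>"
        by (simp add: Kr_def)
      finally show ?thesis .
    qed
    show "norm dx \<le> (Kx + Ky + Ks + Kr) * (sqrt (mu (x, y, s)) + mu (x, y, s)) \<and>
       norm dy \<le> (Kx + Ky + Ks + Kr) * (sqrt (mu (x, y, s)) + mu (x, y, s)) \<and>
       norm ds \<le> (Kx + Ky + Ks + Kr) * (sqrt (mu (x, y, s)) + mu (x, y, s)) \<and>
       norm (?A *v dx + ?\<delta> *\<^sub>R dy + primal_residual P x y) \<le> Ct * (Kx + Ky + Ks + Kr) * mu (x, y, s)"
      unfolding \<mu>_def [symmetric] u_def [symmetric] p_def [symmetric]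
    proof (intro conjI)
      show "norm dx \<le> (Kx + Ky + Ks + Kr) * u"
        by (rule order_trans [OF dx_le mult_right_mono]) (use pos' u in auto)
      show "norm dy \<le> (Kx + Ky + Ks + Kr) * u"
        by (rule order_trans [OF dy_le mult_right_mono]) (use pos' u in auto)
      show "norm ds \<le> (Kx + Ky + Ks + Kr) * u"
        by (rule order_trans [OF ds_le mult_right_mono]) (use pos' u in auto)
      show "norm (?A *v dx + ?\<delta> *\<^sub>R dy + p) \<le> Ct * (Kx + Ky + Ks + Kr) * \<mu>"
        by (rule order_trans [OF r_le]) (use pos' Ct \<mu> in \<open>auto intro!: mult_mono\<close>)
    qed
  qed
qed


section \<open>A uniform lower bound for the step lengths\<close>

text \<open>
  Along the direction, the products \<open>x\<^sub>i s\<^sub>i\<close>, their mean and the residuals change by a term that is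
  linear in \<open>\<alpha>\<close>, which keeps the neighbourhood conditions with a slack proportional to
  \<open>\<alpha> \<mu>\<close>, and by an error of at most \<open>\<alpha>\<^sup>2 B \<mu>\<close>. The four conditions on \<open>\<alpha> * B\<close> make the slack dominate in
  the lower and upper bounds on the products, in the residual bounds, and in the decrease of the gap.
\<close>

lemma step_in_neighbourhood:
  assumes z: "(x, y, s) \<in> N"
    and comp: "\<And>i. s $ i * dx $ i + x $ i * ds $ i = \<sigma> * mu (x, y, s) - x $ i * s $ i"
    and dual: "ds = ppm_\<rho> P *\<^sub>R dx - transpose (ppm_A P) *v dy + dual_residual P x y s"
    and primal: "norm (ppm_A P *v dx + ppm_\<delta> P *\<^sub>R dy + primal_residual P x y)
                   \<le> \<sigma> / (2 * \<gamma>p) * gap (x, y, s)"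
    and prod: "\<And>i. \<bar>dx $ i * ds $ i\<bar> \<le> B * mu (x, y, s)"
    and \<alpha>: "0 \<le> \<alpha>" "\<alpha> \<le> 1"
    and B: "\<alpha> * B \<le> \<sigma> * (1 - \<gamma>l) / 2" "\<alpha> * B \<le> \<sigma> * (\<gamma>u - 1) / (1 + \<gamma>u)"
      "\<alpha> * B \<le> \<sigma> / 2" "\<alpha> * B \<le> \<sigma>bar - \<sigma>"
  shows "(x, y, s) + \<alpha> *\<^sub>R (dx, dy, ds) \<in> N"
    and "gap ((x, y, s) + \<alpha> *\<^sub>R (dx, dy, ds)) \<le> (1 - (1 - \<sigma>bar) * \<alpha>) * gap (x, y, s)"
proof -
  let ?n = "real CARD('n)" and ?A = "ppm_A P"
  define \<mu> where "\<mu> = mu (x, y, s)"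
  define g where "g = gap (x, y, s)"
  define x' where "x' = x + \<alpha> *\<^sub>R dx"
  define y' where "y' = y + \<alpha> *\<^sub>R dy"
  define s' where "s' = s + \<alpha> *\<^sub>R ds"
  define p where "p = primal_residual P x y"
  define q where "q = dual_residual P x y s"
  define r where "r = ?A *v dx + ppm_\<delta> P *\<^sub>R dy + p"
  define e where "e = \<alpha> * \<mu> * (\<alpha> * B)"
  define m where "m = x' \<bullet> s' / ?n"
  have z': "(x, y, s) + \<alpha> *\<^sub>R (dx, dy, ds) = (x', y', s')"
    by (simp add: x'_def y'_def s'_def)
  have g_\<mu>: "g = ?n * \<mu>"
    by (simp add: g_def \<mu>_def)
  have gx: "x \<bullet> s = g"
    by (simp add: g_def gap_def)
  have g: "0 < g"
    using gap_pos [OF z] by (simp add: g_def)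
  then have \<mu>: "0 < \<mu>"
    by (simp add: g_\<mu> zero_less_mult_iff)
  have x's': "x' $ i * s' $ i = (1 - \<alpha>) * (x $ i * s $ i) + \<alpha> * \<sigma> * \<mu> + \<alpha>\<^sup>2 * (dx $ i * ds $ i)" for i
  proof -
    have "x' $ i * s' $ i
        = x $ i * s $ i + \<alpha> * (s $ i * dx $ i + x $ i * ds $ i) + \<alpha>\<^sup>2 * (dx $ i * ds $ i)"
      by (simp add: x'_def s'_def power2_eq_square algebra_simps)
    then show ?thesis
      unfolding comp by (simp add: \<mu>_def algebra_simps)
  qed
  have "x' \<bullet> s' = (\<Sum>i\<in>UNIV. (1 - \<alpha>) * (x $ i * s $ i) + \<alpha> * \<sigma> * \<mu> + \<alpha>\<^sup>2 * (dx $ i * ds $ i))"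
    by (simp add: inner_vec_def x's')
  also have "\<dots> = (1 - \<alpha>) * (x \<bullet> s) + \<alpha> * \<sigma> * (?n * \<mu>) + \<alpha>\<^sup>2 * (dx \<bullet> ds)"
    by (simp add: sum.distrib inner_vec_def flip: sum_distrib_left)
  finally have gap': "x' \<bullet> s' = (1 - \<alpha>) * g + \<alpha> * \<sigma> * g + \<alpha>\<^sup>2 * (dx \<bullet> ds)"
    by (simp add: gx g_\<mu>)
  have e_i: "\<bar>\<alpha>\<^sup>2 * (dx $ i * ds $ i)\<bar> \<le> e" for i
    using mult_left_mono [OF prod [of i], of "\<alpha>\<^sup>2"]
    by (simp add: e_def \<mu>_def abs_mult power2_eq_square mult_ac)
  have "\<bar>\<alpha>\<^sup>2 * (dx \<bullet> ds)\<bar> = \<bar>\<Sum>i\<in>UNIV. \<alpha>\<^sup>2 * (dx $ i * ds $ i)\<bar>"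
    by (simp add: inner_vec_def sum_distrib_left)
  also have "\<dots> \<le> (\<Sum>i\<in>(UNIV :: 'n set). e)"
    by (rule order_trans [OF sum_abs sum_mono]) (rule e_i)
  finally have e_sum: "\<bar>\<alpha>\<^sup>2 * (dx \<bullet> ds)\<bar> \<le> ?n * e"
    by simp
  have "\<bar>m - ((1 - \<alpha>) * \<mu> + \<alpha> * \<sigma> * \<mu>)\<bar> = \<bar>\<alpha>\<^sup>2 * (dx \<bullet> ds)\<bar> / ?n"
    by (simp add: m_def gap' g_\<mu> field_simps)
  also have "\<dots> \<le> e"
    using e_sum by (simp add: pos_divide_le_eq mult.commute)
  finally have m: "\<bar>m - ((1 - \<alpha>) * \<mu> + \<alpha> * \<sigma> * \<mu>)\<bar> \<le> e" .
  have t: "0 \<le> \<alpha> * \<mu>"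
    using \<alpha> \<mu> by simp
  have e1: "2 * e \<le> \<alpha> * \<mu> * (\<sigma> * (1 - \<gamma>l))"
    using mult_left_mono [OF B(1) t] by (simp add: e_def)
  have e2: "(1 + \<gamma>u) * e \<le> \<alpha> * \<mu> * (\<sigma> * (\<gamma>u - 1))"
  proof -
    have "e \<le> \<alpha> * \<mu> * (\<sigma> * (\<gamma>u - 1)) / (1 + \<gamma>u)"
      using mult_left_mono [OF B(2) t] by (simp add: e_def)
    then show ?thesis
      using \<gamma>u by (simp add: pos_le_divide_eq mult.commute)
  qed
  have e3: "2 * e \<le> \<alpha> * \<mu> * \<sigma>"
    using mult_left_mono [OF B(3) t] by (simp add: e_def)
  have e4: "e \<le> \<alpha> * \<mu> * (\<sigma>bar - \<sigma>)"
    using mult_left_mono [OF B(4) t] by (simp add: e_def)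
  have e0: "0 \<le> e"
    using e_i by (meson abs_ge_zero order_trans)
  have ne3: "2 * (?n * e) \<le> \<alpha> * \<sigma> * g"
    using mult_left_mono [OF e3, of ?n] by (simp add: g_\<mu> algebra_simps)
  have ne4: "?n * e \<le> \<alpha> * (\<sigma>bar - \<sigma>) * g"
    using mult_left_mono [OF e4, of ?n] by (simp add: g_\<mu> algebra_simps)
  have "0 < x' $ i \<and> 0 < s' $ i" for i
  proof -
    note i = neighbourhood_ineqs(1,2) [OF z, of i]
    have "0 < (1 - \<alpha>) * (x $ i * s $ i) + \<alpha> * \<mu> * \<sigma> / 2"
    proof (cases "\<alpha> = 1")
      case False
      then have "0 < (1 - \<alpha>) * (x $ i * s $ i)"
        using \<alpha> i by simp
      then show ?thesis
        using t \<sigma> by (simp add: add_pos_nonneg)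
    qed (use \<mu> \<sigma> in simp)
    also have "\<dots> \<le> x' $ i * s' $ i"
      unfolding x's' using e_i [of i] e3 by (simp add: algebra_simps)
    finally have pos: "0 < x' $ i * s' $ i" .
    \<comment> \<open>The components cannot both have become negative, because a positive combination of them
      is positive by the linearised complementarity equation.\<close>
    have "s $ i * x' $ i + x $ i * s' $ i
        = 2 * (x $ i * s $ i) + \<alpha> * (s $ i * dx $ i + x $ i * ds $ i)"
      by (simp add: x'_def s'_def algebra_simps)
    also have "\<dots> = (2 - \<alpha>) * (x $ i * s $ i) + \<alpha> * \<mu> * \<sigma>"
      unfolding comp by (simp add: \<mu>_def algebra_simps)
    also have "\<dots> > 0"
      using \<alpha> i \<mu> \<sigma> by (intro add_pos_nonneg mult_pos_pos mult_nonneg_nonneg) auto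
    finally have "0 < s $ i * x' $ i + x $ i * s' $ i" .
    then show ?thesis
      using pos i by (smt (verit) mult_pos_neg zero_less_mult_iff)
  qed
  moreover have "\<gamma>l * m \<le> x' $ i * s' $ i \<and> x' $ i * s' $ i \<le> \<gamma>u * m" for i
  proof
    note i = neighbourhood_ineqs(3,4) [OF z, of i, folded \<mu>_def]
    have "\<gamma>l * m \<le> \<gamma>l * ((1 - \<alpha>) * \<mu> + \<alpha> * \<sigma> * \<mu> + e)"
      using m \<gamma>l by (intro mult_left_mono) auto
    moreover have "\<gamma>l * e \<le> 1 * e"
      using \<gamma>l e0 by (intro mult_right_mono) auto
    moreover have "(1 - \<alpha>) * (\<gamma>l * \<mu>) \<le> (1 - \<alpha>) * (x $ i * s $ i)"
      using i \<alpha> by (intro mult_left_mono) auto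
    ultimately show "\<gamma>l * m \<le> x' $ i * s' $ i"
      unfolding x's' using e1 e_i [of i] by (simp add: algebra_simps)
    have "\<gamma>u * ((1 - \<alpha>) * \<mu> + \<alpha> * \<sigma> * \<mu> - e) \<le> \<gamma>u * m"
      using m \<gamma>u by (intro mult_left_mono) auto
    moreover have "(1 - \<alpha>) * (x $ i * s $ i) \<le> (1 - \<alpha>) * (\<gamma>u * \<mu>)"
      using i \<alpha> by (intro mult_left_mono) auto
    ultimately show "x' $ i * s' $ i \<le> \<gamma>u * m"
      unfolding x's' using e2 e_i [of i] by (simp add: algebra_simps)
  qed
  moreover have "\<gamma>p * norm (primal_residual P x' y') \<le> x' \<bullet> s'"
  proof -
    have "primal_residual P x' y' = (1 - \<alpha>) *\<^sub>R p + \<alpha> *\<^sub>R r"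
      by (simp add: primal_residual_def p_def r_def x'_def y'_def algebra_simps
          matrix_vector_mult_scaleR)
    then have "norm (primal_residual P x' y') \<le> (1 - \<alpha>) * norm p + \<alpha> * norm r"
      using norm_triangle_ineq [of "(1 - \<alpha>) *\<^sub>R p" "\<alpha> *\<^sub>R r"] \<alpha> by simp
    also have "\<dots> \<le> (1 - \<alpha>) * (g / \<gamma>p) + \<alpha> * (\<sigma> / (2 * \<gamma>p) * g)"
      using neighbourhood_ineqs(5) [OF z] primal \<alpha>
      unfolding p_def [symmetric] r_def [symmetric] g_def [symmetric]
      by (intro add_mono mult_left_mono) auto
    also have "\<dots> = ((1 - \<alpha>) * g + \<alpha> * \<sigma> * g / 2) / \<gamma>p"
      by (simp add: add_divide_distrib)
    finally have "\<gamma>p * norm (primal_residual P x' y') \<le> (1 - \<alpha>) * g + \<alpha> * \<sigma> * g / 2"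
      using \<gamma>p by (simp add: pos_le_divide_eq mult.commute)
    then show ?thesis
      unfolding gap' using e_sum ne3 by linarith
  qed
  moreover have "\<gamma>d * norm (dual_residual P x' y' s') \<le> x' \<bullet> s'"
  proof -
    have "dual_residual P x' y' s' = q + \<alpha> *\<^sub>R (ppm_\<rho> P *\<^sub>R dx - transpose ?A *v dy - ds)"
      by (simp add: dual_residual_def q_def x'_def y'_def s'_def algebra_simps
          matrix_vector_mult_scaleR del: transpose_matrix_vector)
    also have "\<dots> = (1 - \<alpha>) *\<^sub>R q"
      by (simp add: dual q_def algebra_simps)
    finally have "\<gamma>d * norm (dual_residual P x' y' s') = (1 - \<alpha>) * (\<gamma>d * norm q)"
      using \<alpha> by simp
    also have "\<dots> \<le> (1 - \<alpha>) * g"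
      using neighbourhood_ineqs(6) [OF z] \<gamma>d \<alpha> unfolding q_def [symmetric] g_def [symmetric]
      by (intro mult_left_mono) (auto simp: pos_le_divide_eq mult.commute)
    also have "\<dots> \<le> x' \<bullet> s'"
    proof -
      have "0 \<le> ?n * e"
        using e0 by simp
      then show ?thesis
        unfolding gap' using e_sum ne3 by linarith
    qed
    finally show ?thesis .
  qed
  ultimately show "(x, y, s) + \<alpha> *\<^sub>R (dx, dy, ds) \<in> N"
    unfolding z' by (simp add: neighbourhood_def m_def)
  show "gap ((x, y, s) + \<alpha> *\<^sub>R (dx, dy, ds)) \<le> (1 - (1 - \<sigma>bar) * \<alpha>) * gap (x, y, s)"
    unfolding z' using e_sum ne4 by (simp add: gap_def gap' gx algebra_simps)
qed


text \<open>
  The step bound \<open>\<alpha>\<close> is uniform on the part of the neighbourhood where \<open>mu z \<le> \<mu>0\<close>, which contains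
  the whole run if \<open>\<mu>0\<close> is the initial value.
\<close>

lemma uniform_step:
  obtains Cbar K where "0 < Cbar" "0 < K"
    "\<And>Ct z d. z \<in> N \<Longrightarrow> 0 < Ct \<Longrightarrow> is_sparsified_direction P Ct \<sigma> z d \<Longrightarrow>
       norm d \<le> K * (sqrt (mu z) + mu z)"
    "\<And>Ct \<mu>0. 0 < Ct \<Longrightarrow> Ct < Cbar \<Longrightarrow> 0 < \<mu>0 \<Longrightarrow>
       \<exists>\<alpha>>0. \<forall>z\<in>N. \<forall>d. mu z \<le> \<mu>0 \<longrightarrow> is_sparsified_direction P Ct \<sigma> z d \<longrightarrow>
         \<alpha> \<in> admissible_steps P \<gamma>l \<gamma>u \<gamma>p \<gamma>d \<sigma>bar z d"
proof -
  let ?n = "real CARD('n)"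
  obtain K where K: "0 < K"
    and bounds: "\<And>x y s dx dy ds Ct.
       (x, y, s) \<in> N \<Longrightarrow> 0 < Ct \<Longrightarrow> is_sparsified_direction P Ct \<sigma> (x, y, s) (dx, dy, ds) \<Longrightarrow>
       norm dx \<le> K * (sqrt (mu (x, y, s)) + mu (x, y, s)) \<and>
       norm dy \<le> K * (sqrt (mu (x, y, s)) + mu (x, y, s)) \<and>
       norm ds \<le> K * (sqrt (mu (x, y, s)) + mu (x, y, s)) \<and>
       norm (ppm_A P *v dx + ppm_\<delta> P *\<^sub>R dy + primal_residual P x y) \<le> Ct * K * mu (x, y, s)"
    using direction_bounds by blast
  show thesis
  proof (rule that [of "\<sigma> / (2 * \<gamma>p) * ?n / K" "3 * K"])
    show "0 < \<sigma> / (2 * \<gamma>p) * ?n / K" "0 < 3 * K"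
      using K \<sigma> \<gamma>p by simp_all
    show "norm d \<le> 3 * K * (sqrt (mu z) + mu z)"
      if "z \<in> N" "0 < Ct" "is_sparsified_direction P Ct \<sigma> z d" for Ct z d
    proof -
      obtain x y s where z: "z = (x, y, s)" by (cases z)
      obtain dx dy ds where d: "d = (dx, dy, ds)" by (cases d)
      have "norm d \<le> norm dx + (norm dy + norm ds)"
        unfolding d by (rule order_trans [OF norm_Pair_le add_left_mono [OF norm_Pair_le]])
      also have "\<dots> \<le> 3 * K * (sqrt (mu z) + mu z)"
        using bounds [OF that(1) [unfolded z] that(2) that(3) [unfolded z d]]
        unfolding z by (simp add: mult.assoc)
      finally show ?thesis .
    qed
    fix Ct \<mu>0 :: real
    assume Ct: "0 < Ct" "Ct < \<sigma> / (2 * \<gamma>p) * ?n / K" and \<mu>0: "0 < \<mu>0"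
    define B where "B = 2 * K\<^sup>2 * (1 + \<mu>0)"
    define \<kappa> where "\<kappa> = min (min (\<sigma> * (1 - \<gamma>l) / 2) (\<sigma> * (\<gamma>u - 1) / (1 + \<gamma>u)))
                            (min (\<sigma> / 2) (\<sigma>bar - \<sigma>))"
    define \<alpha> where "\<alpha> = min 1 (\<kappa> / B)"
    have B: "0 < B"
      using K \<mu>0 by (simp add: B_def)
    have "0 < \<kappa>"
      using \<sigma> \<gamma>l \<gamma>u by (simp add: \<kappa>_def)
    then have "0 < \<alpha>"
      using B by (simp add: \<alpha>_def)
    moreover have "\<alpha> \<in> admissible_steps P \<gamma>l \<gamma>u \<gamma>p \<gamma>d \<sigma>bar z d"
      if z: "z \<in> N" and le: "mu z \<le> \<mu>0" and dir: "is_sparsified_direction P Ct \<sigma> z d" for z d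
    proof -
      obtain x y s where z_eq: "z = (x, y, s)" by (cases z)
      obtain dx dy ds where d_eq: "d = (dx, dy, ds)" by (cases d)
      note N = z [unfolded z_eq] and D = dir [unfolded z_eq d_eq]
      define \<mu> where "\<mu> = mu (x, y, s)"
      have \<mu>: "0 < \<mu>"
        using gap_pos [OF N] by (simp add: \<mu>_def)
      note bd = bounds [OF N Ct(1) D, folded \<mu>_def]
      have dual: "ds = ppm_\<rho> P *\<^sub>R dx - transpose (ppm_A P) *v dy + dual_residual P x y s"
        by (rule sparsified_direction_equations [OF D neighbourhood_ineqs(1,2) [OF N] \<rho> Ct(1)]) assumption
      have comp: "s $ i * dx $ i + x $ i * ds $ i = \<sigma> * mu (x, y, s) - x $ i * s $ i" for i
        unfolding gap_def prod.case
        by (rule sparsified_direction_equations [OF D neighbourhood_ineqs(1,2) [OF N] \<rho> Ct(1)]) assumption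
      have prod: "\<bar>dx $ i * ds $ i\<bar> \<le> B * \<mu>" for i
      proof -
        have "\<bar>dx $ i\<bar> * \<bar>ds $ i\<bar> \<le> (K * (sqrt \<mu> + \<mu>)) * (K * (sqrt \<mu> + \<mu>))"
          using bd component_le_norm_cart [of dx i] component_le_norm_cart [of ds i] K \<mu>
          by (intro mult_mono) auto
        also have "\<dots> = K\<^sup>2 * (sqrt \<mu> + \<mu>)\<^sup>2"
          by (simp add: power2_eq_square)
        also have "\<dots> \<le> K\<^sup>2 * (2 * (\<mu> + \<mu>\<^sup>2))"
        proof (rule mult_left_mono)
          show "(sqrt \<mu> + \<mu>)\<^sup>2 \<le> 2 * (\<mu> + \<mu>\<^sup>2)"
            using \<mu> zero_le_power2 [of "sqrt \<mu> - \<mu>"] by (simp add: power2_sum power2_diff)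
        qed simp
        also have "\<dots> = 2 * K\<^sup>2 * (1 + \<mu>) * \<mu>"
          by (simp add: power2_eq_square algebra_simps)
        also have "\<dots> \<le> B * \<mu>"
          using le \<mu> unfolding B_def \<mu>_def z_eq by (intro mult_right_mono mult_left_mono) auto
        finally show ?thesis
          by (simp add: abs_mult)
      qed
      have "Ct * K \<le> \<sigma> / (2 * \<gamma>p) * ?n"
        using pos_less_divide_eq [OF K, THEN iffD1, OF Ct(2)] by (rule less_imp_le)
      then have "Ct * K * \<mu> \<le> \<sigma> / (2 * \<gamma>p) * ?n * \<mu>"
        using \<mu> by (intro mult_right_mono) auto
      also have "\<dots> = \<sigma> / (2 * \<gamma>p) * gap (x, y, s)"
        by (simp add: \<mu>_def)
      finally have primal: "norm (ppm_A P *v dx + ppm_\<delta> P *\<^sub>R dy + primal_residual P x y)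
          \<le> \<sigma> / (2 * \<gamma>p) * gap (x, y, s)"
        using bd by linarith
      have "z + \<alpha>' *\<^sub>R d \<in> N \<and> gap (z + \<alpha>' *\<^sub>R d) \<le> (1 - (1 - \<sigma>bar) * \<alpha>') * gap z"
        if \<alpha>': "\<alpha>' \<in> {0..\<alpha>}" for \<alpha>'
      proof -
        have "\<alpha>' * B \<le> \<kappa> / B * B"
          using \<alpha>' B unfolding \<alpha>_def by (intro mult_right_mono) auto
        then have "\<alpha>' * B \<le> \<kappa>"
          using B by simp
        moreover have "0 \<le> \<alpha>'" "\<alpha>' \<le> 1"
          using \<alpha>' by (auto simp: \<alpha>_def)
        ultimately show ?thesis
          unfolding z_eq d_eq
          using step_in_neighbourhood [OF N comp dual primal prod [unfolded \<mu>_def], of \<alpha>']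
          by (simp add: \<kappa>_def)
      qed
      then show ?thesis
        using \<open>0 < \<alpha>\<close> by (auto simp: admissible_steps_def \<alpha>_def)
    qed
    ultimately show "\<exists>\<alpha>>0. \<forall>z\<in>N. \<forall>d. mu z \<le> \<mu>0 \<longrightarrow> is_sparsified_direction P Ct \<sigma> z d \<longrightarrow>
         \<alpha> \<in> admissible_steps P \<gamma>l \<gamma>u \<gamma>p \<gamma>d \<sigma>bar z d"
      by blast
  qed
qed


section \<open>Existence of the maximal step\<close>

lemma closure_ineqs:
  assumes "(x, y, s) \<in> closure N"
  shows "0 \<le> x $ i" "0 \<le> s $ i"
    "\<gamma>l * mu (x, y, s) \<le> x $ i * s $ i" "x $ i * s $ i \<le> \<gamma>u * mu (x, y, s)"
    "\<gamma>p * norm (primal_residual P x y) \<le> gap (x, y, s)"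
    "\<gamma>d * norm (dual_residual P x y s) \<le> gap (x, y, s)"
proof -
  define W where "W = {z :: ('n, 'm) point.
     (\<forall>i. 0 \<le> fst z $ i \<and> 0 \<le> snd (snd z) $ i \<and>
       \<gamma>l * (fst z \<bullet> snd (snd z) / real CARD('n)) \<le> fst z $ i * snd (snd z) $ i \<and>
       fst z $ i * snd (snd z) $ i \<le> \<gamma>u * (fst z \<bullet> snd (snd z) / real CARD('n))) \<and>
     \<gamma>p * norm (primal_residual P (fst z) (fst (snd z))) \<le> fst z \<bullet> snd (snd z) \<and>
     \<gamma>d * norm (dual_residual P (fst z) (fst (snd z)) (snd (snd z))) \<le> fst z \<bullet> snd (snd z)}"
  have mv: "continuous_on UNIV (\<lambda>z. M *v f z)" if "continuous_on UNIV f"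
    for M :: "real ^ 'p::finite ^ 'q::finite" and f :: "('n, 'm) point \<Rightarrow> real ^ 'p"
    using bounded_linear.continuous_on [OF matrix_vector_mul_bounded_linear that] .
  have "closed W"
    unfolding W_def primal_residual_def dual_residual_def
    by (intro closed_Collect_conj closed_Collect_all closed_Collect_le continuous_intros mv) auto
  moreover have "N \<subseteq> W"
    using neighbourhood_ineqs \<gamma>p \<gamma>d
    by (auto simp: W_def gap_def pos_le_divide_eq mult.commute less_imp_le)
  ultimately have "(x, y, s) \<in> W"
    using assms closure_minimal by blast
  then show "0 \<le> x $ i" "0 \<le> s $ i"
    "\<gamma>l * mu (x, y, s) \<le> x $ i * s $ i" "x $ i * s $ i \<le> \<gamma>u * mu (x, y, s)"
    "\<gamma>p * norm (primal_residual P x y) \<le> gap (x, y, s)"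
    "\<gamma>d * norm (dual_residual P x y s) \<le> gap (x, y, s)"
    by (auto simp: W_def gap_def)
qed

lemma closure_is_solution:
  assumes "z \<in> closure N" "gap z = 0"
  shows "is_solution P z"
proof -
  obtain x y s where z: "z = (x, y, s)" by (cases z)
  have "norm (primal_residual P x y) \<le> 0" "norm (dual_residual P x y s) \<le> 0"
    using closure_ineqs(5,6) [OF assms(1) [unfolded z]] assms(2) \<gamma>p \<gamma>d
    by (simp_all add: z mult_le_0_iff)
  then show ?thesis
    using closure_ineqs(1,2) [OF assms(1) [unfolded z]] assms(2)
    by (simp add: z is_solution_def gap_def less_eq_vec_def)
qed

lemma closure_in_neighbourhood:
  assumes "z \<in> closure N" "gap z \<noteq> 0"
  shows "z \<in> N"
proof -
  obtain x y s where z: "z = (x, y, s)" by (cases z)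
  note c = closure_ineqs [OF assms(1) [unfolded z]]
  have "0 \<le> gap (x, y, s)"
    unfolding gap_def prod.case inner_vec_def using c(1,2) by (auto intro!: sum_nonneg)
  then have "0 < gap (x, y, s)"
    using assms(2) by (simp add: z)
  then have "0 < x $ i * s $ i" for i
    using c(3) [of i] \<gamma>l by (smt (verit) divide_pos_pos mult_pos_pos of_nat_0_less_iff zero_less_card_finite)
  then have "0 < x $ i \<and> 0 < s $ i" for i
    using c(1,2) [of i] by (metis less_eq_real_def mult_zero_left mult_zero_right)
  then show ?thesis
    using c by (simp add: z neighbourhood_def gap_def)
qed

text \<open>
  At a limit point with zero gap some component of \<open>x\<close> or \<open>s\<close> vanishes, so no longer step keeps both
  vectors nonnegative.
\<close>

lemma max_step_eq:
  assumes z: "z \<in> N" and a: "0 < a" and cl: "z + a *\<^sub>R d \<in> closure N" and gap: "gap (z + a *\<^sub>R d) = 0"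
  shows "max_step z d = ereal a"
proof -
  obtain x y s where z_eq: "z = (x, y, s)" by (cases z)
  obtain dx dy ds where d_eq: "d = (dx, dy, ds)" by (cases d)
  define F where "F = (\<lambda>t dt :: real ^ 'n. SUP \<alpha>\<in>{\<alpha>. 0 \<le> t + \<alpha> *\<^sub>R dt}. ereal \<alpha>)"
  have le_F: "ereal a \<le> F t dt" if "0 \<le> t + a *\<^sub>R dt" for t dt
    unfolding F_def using that by (intro SUP_upper) auto
  have F_le: "F t dt \<le> ereal a" if t: "0 < t $ i" "t $ i + a * dt $ i = 0" for t dt i
    unfolding F_def
  proof (rule SUP_least)
    fix \<alpha> assume "\<alpha> \<in> {\<alpha>. 0 \<le> t + \<alpha> *\<^sub>R dt}"
    then have "0 \<le> t $ i + \<alpha> * dt $ i"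
      by (simp add: less_eq_vec_def)
    then have "(\<alpha> - a) * dt $ i \<ge> 0"
      using t by (simp add: algebra_simps)
    moreover have "dt $ i < 0"
      using t a by (smt (verit) mult_nonneg_nonneg)
    ultimately show "ereal \<alpha> \<le> ereal a"
      by (simp add: zero_le_mult_iff)
  qed
  have cl': "(x + a *\<^sub>R dx, y + a *\<^sub>R dy, s + a *\<^sub>R ds) \<in> closure N"
    and gap': "gap (x + a *\<^sub>R dx, y + a *\<^sub>R dy, s + a *\<^sub>R ds) = 0"
    using cl gap by (simp_all add: z_eq d_eq)
  note c = closure_ineqs(1-4) [OF cl']
  have "0 \<le> x + a *\<^sub>R dx" "0 \<le> s + a *\<^sub>R ds"
    using c by (simp_all add: less_eq_vec_def)
  then have "ereal a \<le> min (F x dx) (F s ds)"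
    using le_F by simp
  moreover have "min (F x dx) (F s ds) \<le> ereal a"
  proof -
    have "(x + a *\<^sub>R dx) $ i * (s + a *\<^sub>R ds) $ i = 0" for i
      using c(3,4) [of i] unfolding gap' by simp
    then have "x $ undefined + a * dx $ undefined = 0 \<or> s $ undefined + a * ds $ undefined = 0"
      by simp
    then show ?thesis
      using F_le neighbourhood_ineqs(1,2) [OF z [unfolded z_eq], of undefined] by (meson min.coboundedI1 min.coboundedI2)
  qed
  ultimately show ?thesis
    unfolding max_step_def z_eq d_eq F_def prod.case by (rule antisym [rotated])
qed

lemma continuous_on_gap: "continuous_on UNIV (gap :: ('n, 'm) point \<Rightarrow> real)"
  unfolding gap_def case_prod_beta by (intro continuous_intros)

lemma greatest_admissible_step:
  fixes z d :: "('n, 'm) point"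
  defines "S \<equiv> admissible_steps P \<gamma>l \<gamma>u \<gamma>p \<gamma>d \<sigma>bar z d"
    and "\<alpha> \<equiv> step_length P \<gamma>l \<gamma>u \<gamma>p \<gamma>d \<sigma>bar z d"
  assumes z: "z \<in> N" and run: "\<not> stops P z d"
  shows "\<alpha> \<in> S" and "\<And>\<beta>. \<beta> \<in> S \<Longrightarrow> \<beta> \<le> \<alpha>"
proof -
  define good where "good = (\<lambda>\<beta>. z + \<beta> *\<^sub>R d \<in> N \<and>
     gap (z + \<beta> *\<^sub>R d) \<le> (1 - (1 - \<sigma>bar) * \<beta>) * gap z)"
  have S: "S = {\<beta> \<in> {0..1}. \<forall>\<beta>'\<in>{0..\<beta>}. good \<beta>'}"
    by (simp add: S_def admissible_steps_def good_def)
  define a where "a = Sup S"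
  have "0 \<in> S"
    using z by (auto simp: S good_def)
  have bdd: "bdd_above S"
    by (rule bdd_aboveI [of _ 1]) (simp add: S)
  have a_ge: "\<beta> \<le> a" if "\<beta> \<in> S" for \<beta>
    unfolding a_def using that bdd by (rule cSup_upper)
  have "0 \<le> a"
    using a_ge \<open>0 \<in> S\<close> .
  have "a \<le> 1"
    unfolding a_def
  proof (rule cSup_least)
    show "S \<noteq> {}"
      using \<open>0 \<in> S\<close> by blast
  qed (simp add: S)
  have below: "good \<beta>" if \<beta>: "0 \<le> \<beta>" "\<beta> < a" for \<beta>
  proof -
    obtain \<beta>' where "\<beta>' \<in> S" "\<beta> < \<beta>'"
      using \<beta> less_cSup_iff [OF _ bdd, of \<beta>] \<open>0 \<in> S\<close> unfolding a_def by blast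
    then show ?thesis
      using \<beta> by (simp add: S)
  qed
  have "good a"
  proof (cases "a = 0")
    case True
    then show ?thesis
      using z by (simp add: good_def)
  next
    case False
    then have "0 < a"
      using \<open>0 \<le> a\<close> by simp
    define b where "b = (\<lambda>k. a * (1 - inverse (real (Suc k))))"
    have b: "0 \<le> b k" "b k < a" for k
      using \<open>0 < a\<close> by (auto simp: b_def field_simps)
    have "b \<longlonglongrightarrow> a * (1 - 0)"
      unfolding b_def by (intro tendsto_intros LIMSEQ_inverse_real_of_nat)
    then have b_lim: "b \<longlonglongrightarrow> a"
      by simp
    then have z_lim: "(\<lambda>k. z + b k *\<^sub>R d) \<longlonglongrightarrow> z + a *\<^sub>R d"
      by (intro tendsto_intros)
    then have cl: "z + a *\<^sub>R d \<in> closure N"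
      unfolding closure_sequential using below [OF b]
      by (intro exI [of _ "\<lambda>k. z + b k *\<^sub>R d"]) (simp add: good_def)
    have "(\<lambda>k. gap (z + b k *\<^sub>R d)) \<longlonglongrightarrow> gap (z + a *\<^sub>R d)"
      using continuous_on_tendsto_compose [OF continuous_on_gap z_lim] by simp
    moreover have "(\<lambda>k. (1 - (1 - \<sigma>bar) * b k) * gap z) \<longlonglongrightarrow> (1 - (1 - \<sigma>bar) * a) * gap z"
      using b_lim by (intro tendsto_intros)
    ultimately have "gap (z + a *\<^sub>R d) \<le> (1 - (1 - \<sigma>bar) * a) * gap z"
      by (rule LIMSEQ_le) (use below [OF b] in \<open>simp add: good_def\<close>)
    \<comment> \<open>The neighbourhood is not closed, but a limit point outside of it is a solution, and it is
      attained exactly at the step to the boundary of the positive orthant.\<close>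
    moreover have "gap (z + a *\<^sub>R d) \<noteq> 0"
    proof
      assume gap0: "gap (z + a *\<^sub>R d) = 0"
      have "max_step z d = ereal a"
        by (rule max_step_eq [OF z \<open>0 < a\<close> cl gap0])
      then have "stops P z d"
        unfolding stops_def using closure_is_solution [OF cl gap0] by simp
      with run show False ..
    qed
    ultimately show ?thesis
      unfolding good_def using closure_in_neighbourhood [OF cl] by blast
  qed
  then have "a \<in> S"
    using \<open>0 \<le> a\<close> \<open>a \<le> 1\<close> below by (auto simp: S le_less)
  then have "\<alpha> = a"
    unfolding \<alpha>_def step_length_def S_def [symmetric] using a_ge by (intro Greatest_equality) auto
  then show "\<alpha> \<in> S" "\<And>\<beta>. \<beta> \<in> S \<Longrightarrow> \<beta> \<le> \<alpha>"
    using \<open>a \<in> S\<close> a_ge by auto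
qed


section \<open>Convergence\<close>

lemma sparsified_run_converges:
  "\<exists>Cbar>0. \<forall>Ct. 0 < Ct \<and> Ct < Cbar \<longrightarrow>
     (\<forall>z d. nonstopping_run P \<gamma>l \<gamma>u \<gamma>p \<gamma>d \<sigma>bar z d \<and>
            (\<forall>j. is_sparsified_direction P Ct \<sigma> (z j) (d j)) \<longrightarrow>
        (\<forall>j. z j \<in> N) \<and> (\<lambda>j. gap (z j)) \<longlonglongrightarrow> 0 \<and> (\<exists>zstar. is_solution P zstar \<and> z \<longlonglongrightarrow> zstar))"
proof -
  obtain Cbar K where "0 < Cbar" and K: "0 < K"
    and norm_dir: "\<And>Ct z d. z \<in> N \<Longrightarrow> 0 < Ct \<Longrightarrow> is_sparsified_direction P Ct \<sigma> z d \<Longrightarrow>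
       norm d \<le> K * (sqrt (mu z) + mu z)"
    and unif: "\<And>Ct \<mu>0. 0 < Ct \<Longrightarrow> Ct < Cbar \<Longrightarrow> 0 < \<mu>0 \<Longrightarrow>
       \<exists>\<alpha>>0. \<forall>z\<in>N. \<forall>d. mu z \<le> \<mu>0 \<longrightarrow> is_sparsified_direction P Ct \<sigma> z d \<longrightarrow>
         \<alpha> \<in> admissible_steps P \<gamma>l \<gamma>u \<gamma>p \<gamma>d \<sigma>bar z d"
    by (rule uniform_step) (rule that; assumption)
  show ?thesis
  proof (rule exI [of _ Cbar], rule conjI [OF \<open>0 < Cbar\<close>], intro allI impI)
    fix Ct :: real and z d :: "nat \<Rightarrow> ('n, 'm) point"
    assume "0 < Ct \<and> Ct < Cbar"
      and "nonstopping_run P \<gamma>l \<gamma>u \<gamma>p \<gamma>d \<sigma>bar z d \<and> (\<forall>j. is_sparsified_direction P Ct \<sigma> (z j) (d j))"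
    then have Ct: "0 < Ct" "Ct < Cbar" and run: "nonstopping_run P \<gamma>l \<gamma>u \<gamma>p \<gamma>d \<sigma>bar z d"
      and dir: "\<And>j. is_sparsified_direction P Ct \<sigma> (z j) (d j)"
      by simp_all
    define \<alpha> where "\<alpha> = (\<lambda>j. step_length P \<gamma>l \<gamma>u \<gamma>p \<gamma>d \<sigma>bar (z j) (d j))"
    have z0: "z 0 \<in> N" and ns: "\<not> stops P (z j) (d j)"
      and z_Suc: "z (Suc j) = z j + \<alpha> j *\<^sub>R d j" for j
      using run by (simp_all add: nonstopping_run_def \<alpha>_def)
    have step: "0 \<le> \<alpha> j" "\<alpha> j \<le> 1" "z (Suc j) \<in> N"
      "gap (z (Suc j)) \<le> (1 - (1 - \<sigma>bar) * \<alpha> j) * gap (z j)" if "z j \<in> N" for j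
    proof -
      have "\<alpha> j \<in> admissible_steps P \<gamma>l \<gamma>u \<gamma>p \<gamma>d \<sigma>bar (z j) (d j)"
        unfolding \<alpha>_def by (rule greatest_admissible_step(1) [OF that ns])
      then show "0 \<le> \<alpha> j" "\<alpha> j \<le> 1" "z (Suc j) \<in> N"
        "gap (z (Suc j)) \<le> (1 - (1 - \<sigma>bar) * \<alpha> j) * gap (z j)"
        unfolding z_Suc by (simp_all add: admissible_steps_def)
    qed
    have zN: "z j \<in> N" for j
      by (induction j) (use z0 step in auto)
    note step = step [OF zN]
    have gap_mono: "gap (z j) \<le> gap (z 0)" for j
    proof (induction j)
      case (Suc j)
      have "(1 - (1 - \<sigma>bar) * \<alpha> j) * gap (z j) \<le> 1 * gap (z j)"
        using \<sigma> step(1) [of j] gap_pos [OF zN, of j] by (intro mult_right_mono) auto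
      then show ?case
        using step(4) [of j] Suc by linarith
    qed simp
    define \<mu>0 where "\<mu>0 = mu (z 0)"
    have \<mu>0: "0 < \<mu>0"
      using gap_pos [OF z0] by (simp add: \<mu>0_def)
    obtain \<beta> where \<beta>: "0 < \<beta>" and \<beta>_adm: "\<And>z d. z \<in> N \<Longrightarrow> mu z \<le> \<mu>0 \<Longrightarrow>
        is_sparsified_direction P Ct \<sigma> z d \<Longrightarrow> \<beta> \<in> admissible_steps P \<gamma>l \<gamma>u \<gamma>p \<gamma>d \<sigma>bar z d"
      using unif [OF Ct \<mu>0] by blast
    have mu_le: "mu (z j) \<le> \<mu>0" for j
      unfolding \<mu>0_def using gap_mono by (intro divide_right_mono) auto
    have \<beta>_le: "\<beta> \<le> \<alpha> j" for j
      unfolding \<alpha>_def by (intro greatest_admissible_step(2) [OF zN ns] \<beta>_adm zN mu_le dir)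
    \<comment> \<open>The contraction factor for the gap that corresponds to the smallest possible step.\<close>
    define \<theta> where "\<theta> = 1 - (1 - \<sigma>bar) * \<beta>"
    have \<theta>: "0 < \<theta>" "\<theta> < 1"
    proof -
      have "(1 - \<sigma>bar) * \<beta> \<le> 1 - \<sigma>bar"
        using \<sigma> \<beta>_le [of 0] step(2) [of 0] by (intro mult_left_le) auto
      then show "0 < \<theta>"
        unfolding \<theta>_def using \<sigma> by linarith
      show "\<theta> < 1"
        using \<sigma> \<beta> by (simp add: \<theta>_def)
    qed
    have mu_geom: "mu (z j) \<le> \<theta> ^ j * \<mu>0" for j
    proof (induction j)
      case (Suc j)
      have "gap (z (Suc j)) \<le> \<theta> * gap (z j)"
      proof (rule order_trans [OF step(4)], rule mult_right_mono)
        show "1 - (1 - \<sigma>bar) * \<alpha> j \<le> \<theta>"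
          unfolding \<theta>_def using \<beta>_le [of j] \<sigma> by simp
      qed (use gap_pos [OF zN, of j] in simp)
      then have "mu (z (Suc j)) \<le> \<theta> * mu (z j)"
        by (simp add: divide_right_mono)
      also have "\<dots> \<le> \<theta> * (\<theta> ^ j * \<mu>0)"
        using Suc \<theta> by (intro mult_left_mono) auto
      finally show ?case
        by simp
    qed (simp add: \<mu>0_def)
    have "(\<lambda>j. \<theta> ^ j * \<mu>0) \<longlonglongrightarrow> 0 * \<mu>0"
      using \<theta> by (intro tendsto_intros LIMSEQ_power_zero) auto
    then have mu_lim: "(\<lambda>j. mu (z j)) \<longlonglongrightarrow> 0"
      using mu_geom gap_pos [OF zN]
      by (intro tendsto_sandwich [of "\<lambda>_. 0" "\<lambda>j. mu (z j)" sequentially "\<lambda>j. \<theta> ^ j * \<mu>0"])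
        (auto simp: less_imp_le)
    have gap_lim: "(\<lambda>j. gap (z j)) \<longlonglongrightarrow> 0"
      using tendsto_mult_right_zero [OF mu_lim, of "real CARD('n)"] by simp
    have increment: "norm (z (Suc j) - z j) \<le> K * (sqrt \<mu>0 * sqrt \<theta> ^ j + \<mu>0 * \<theta> ^ j)" for j
    proof -
      have "norm (z (Suc j) - z j) = \<alpha> j * norm (d j)"
        using step(1) by (simp add: z_Suc)
      also have "\<dots> \<le> norm (d j)"
        using step(1,2) by (intro mult_left_le_one_le) auto
      also have "\<dots> \<le> K * (sqrt (mu (z j)) + mu (z j))"
        by (rule norm_dir [OF zN Ct(1) dir])
      also have "\<dots> \<le> K * (sqrt (\<theta> ^ j * \<mu>0) + \<theta> ^ j * \<mu>0)"
        using mu_geom [of j] K by (intro mult_left_mono add_mono real_sqrt_le_mono) auto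
      finally show ?thesis
        by (simp add: real_sqrt_mult real_sqrt_power mult.commute)
    qed
    have "summable (\<lambda>j. K * (sqrt \<mu>0 * sqrt \<theta> ^ j + \<mu>0 * \<theta> ^ j))"
      using \<theta> by (intro summable_mult summable_add summable_geometric) auto
    then have "summable (\<lambda>j. z (Suc j) - z j)"
      by (rule summable_comparison_test') (rule increment)
    then obtain L where "(\<lambda>j. z (Suc j) - z j) sums L"
      by (auto simp: summable_def)
    then have "(\<lambda>j. z j - z 0) \<longlonglongrightarrow> L"
      by (simp add: sums_def sum_lessThan_telescope)
    then have "(\<lambda>j. z j - z 0 + z 0) \<longlonglongrightarrow> L + z 0"
      by (intro tendsto_intros)
    then have z_lim: "z \<longlonglongrightarrow> L + z 0"
      by simp
    have cl: "L + z 0 \<in> closure N"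
      unfolding closure_sequential using zN z_lim by (intro exI [of _ z]) simp
    have "(\<lambda>j. gap (z j)) \<longlonglongrightarrow> gap (L + z 0)"
      using continuous_on_tendsto_compose [OF continuous_on_gap z_lim] by simp
    then have "gap (L + z 0) = 0"
      using gap_lim LIMSEQ_unique by blast
    then have "is_solution P (L + z 0)"
      by (rule closure_is_solution [OF cl])
    then show "(\<forall>j. z j \<in> N) \<and> (\<lambda>j. gap (z j)) \<longlonglongrightarrow> 0 \<and>
        (\<exists>zstar. is_solution P zstar \<and> z \<longlonglongrightarrow> zstar)"
      using zN gap_lim z_lim by blast
  qed
qed

end

theorem corollary4:
  fixes E :: "('m::finite \<times> 'm) set"
    and edge :: "'n::finite \<Rightarrow> 'm \<times> 'm"
    and c xk :: "real ^ 'n"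
    and \<rho>0 \<rho>1 yk :: "real ^ 'm"
    and \<rho> \<delta> \<gamma>l \<gamma>u \<gamma>p \<gamma>d \<sigma> \<sigma>bar Cinexact :: real
    and P :: "('n, 'm) ppm"
  assumes "bij_betw edge UNIV E"
    and "irrefl E"
    and "connected_digraph E"
    and "0 \<le> c"
    and "0 \<le> \<rho>0" and "(\<Sum>v\<in>UNIV. \<rho>0 $ v) = 1"
    and "0 \<le> \<rho>1" and "(\<Sum>v\<in>UNIV. \<rho>1 $ v) = 1"
    and "\<rho> > 0" and "\<delta> > 0"
    and "0 < \<gamma>l" and "\<gamma>l < 1" and "1 < \<gamma>u"
    and "\<gamma>p > 0" and "\<gamma>d > 0"
    and "0 < \<sigma>" and "\<sigma> < \<sigma>bar" and "\<sigma>bar < 1"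
    and "0 < Cinexact" and "Cinexact < 1" and "\<gamma>p * Cinexact < \<sigma>"
    and "P = \<lparr>ppm_A = incidence_matrix edge, ppm_b = \<rho>1 - \<rho>0, ppm_c = c,
              ppm_\<rho> = \<rho>, ppm_\<delta> = \<delta>, ppm_xk = xk, ppm_yk = yk\<rparr>"
  shows "\<exists>Cbar>0. \<forall>Ct. 0 < Ct \<and> Ct < Cbar \<longrightarrow>
           (\<forall>z d. nonstopping_run P \<gamma>l \<gamma>u \<gamma>p \<gamma>d \<sigma>bar z d \<and>
                  (\<forall>j. is_sparsified_direction P Ct \<sigma> (z j) (d j)) \<longrightarrow>
              (\<forall>j. z j \<in> neighbourhood P \<gamma>l \<gamma>u \<gamma>p \<gamma>d) \<and>
              (\<lambda>j. gap (z j)) \<longlonglongrightarrow> 0 \<and>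
              (\<exists>zstar. is_solution P zstar \<and> z \<longlonglongrightarrow> zstar))"
proof -
  interpret inexact_ipm P \<gamma>l \<gamma>u \<gamma>p \<gamma>d \<sigma> \<sigma>bar
    using assms by unfold_locales simp_all
  show ?thesis
    by (rule sparsified_run_converges)
qed

end
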